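(* Let $n \geq 1$ and let $\varphi$ be a Boolean formula in Precise Conjunctive Normal Form whose variables are among a set of $n$ variables. If $\varphi$ has more than $f(n) = \sum_{i=1}^{n} 2^{i}\binom{n}{i} - \sum_{i=1}^{n}\binom{n}{i}$ $(=3^n-2^n)$ clauses, then $\varphi$ has no satisfying truth assignment.
   Context: A literal is a variable $x$ or its complement $\sim x$. A clause is a (nonempty) disjunction of literals; a formula in conjunctive normal form is a conjunction of clauses. A Boolean formula is in Precise Conjunctive Normal Form (PCNF) if it is a conjunction of pairwise distinct clauses, where each clause is a disjunction of pairwise distinct literals and no clause contains both a variable and its complement. Clauses are identified as sets of literals. A truth assignment satisfies the formula if it makes every clause true. *)

theory Defs
  imports Complex_Main
begin

datatype 'v literal = Pos 'v | Neg 'v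

type_synonym 'v clause = "'v literal list"
type_synonym 'v cnf = "'v clause list"

primrec literal_var :: "'v literal \<Rightarrow> 'v" where
  "literal_var (Pos x) = x"
| "literal_var (Neg x) = x"

definition cnf_vars :: "'v cnf \<Rightarrow> 'v set" where
  "cnf_vars F = (\<Union>C\<in>set F. literal_var ` set C)"

primrec literal_true :: "('v \<Rightarrow> bool) \<Rightarrow> 'v literal \<Rightarrow> bool" where
  "literal_true a (Pos x) \<longleftrightarrow> a x"
| "literal_true a (Neg x) \<longleftrightarrow> \<not> a x"

definition clause_true :: "('v \<Rightarrow> bool) \<Rightarrow> 'v clause \<Rightarrow> bool" where
  "clause_true a C \<longleftrightarrow> (\<exists>l\<in>set C. literal_true a l)"

definition satisfies :: "('v \<Rightarrow> bool) \<Rightarrow> 'v cnf \<Rightarrow> bool" where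
  "satisfies a F \<longleftrightarrow> (\<forall>C\<in>set F. clause_true a C)"

definition satisfiable :: "'v cnf \<Rightarrow> bool" where
  "satisfiable F \<longleftrightarrow> (\<exists>a. satisfies a F)"

definition precise_clause :: "'v clause \<Rightarrow> bool" where
  "precise_clause C \<longleftrightarrow> C \<noteq> [] \<and> distinct C \<and> \<not> (\<exists>x. Pos x \<in> set C \<and> Neg x \<in> set C)"

text \<open>Clauses are compared as sets of literals: two clauses that differ only in the order of
  their literals are not distinct. Hence \<open>distinct (map set F)\<close> and not just \<open>distinct F\<close>.\<close>

definition pcnf :: "'v cnf \<Rightarrow> bool" where
  "pcnf F \<longleftrightarrow> distinct (map set F) \<and> (\<forall>C\<in>set F. precise_clause C)"

text \<open>Integer-valued, so that the subtraction is not truncated.\<close>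

definition clause_bound :: "nat \<Rightarrow> int" where
  "clause_bound n = (\<Sum>i=1..n. 2 ^ i * int (n choose i)) - (\<Sum>i=1..n. int (n choose i))"

end

theory Submission
  imports Defs "HOL-Library.FuncSet"
begin

text \<open>A precise clause over \<open>V\<close> is a partial sign assignment on \<open>V\<close>, of which there are \<open>3 ^ n\<close>.
  The clauses made false by a fixed assignment \<open>a\<close>, together with the empty clause, are those whose
  signs all disagree with \<open>a\<close>; there are \<open>2 ^ n\<close> of these, so \<open>a\<close> satisfies at most
  \<open>3 ^ n - 2 ^ n\<close> precise clauses.\<close>

text \<open>Binomial theorem without its term at 0. Of the two sums in \<open>clause_bound\<close>,
  one is the case \<open>x = 2\<close> and the other \<open>x = 1\<close>; the two
  \<open>- 1\<close> cancel.\<close>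

lemma sum_power_binomial_from_1:
  fixes x :: int
  shows "(\<Sum>i=1..n. x ^ i * int (n choose i)) = (x + 1) ^ n - 1"
proof -
  have "(x + 1) ^ n = (\<Sum>i=0..n. x ^ i * int (n choose i))"
    by (simp add: binomial_ring atMost_atLeast0 mult.commute)
  also have "\<dots> = 1 + (\<Sum>i=1..n. x ^ i * int (n choose i))"
    by (simp add: sum.atLeast_Suc_atMost)
  finally show ?thesis by simp
qed

lemma clause_bound_eq: "clause_bound n = 3 ^ n - 2 ^ n"
  using sum_power_binomial_from_1[of 2 n] sum_power_binomial_from_1[of 1 n]
  by (simp add: clause_bound_def)

text \<open>Restricting to \<open>V\<close> makes the values extensional, so that they lie in a
  finite \<open>PiE\<close> space whose cardinality is a power.\<close>

definition signs :: "'v set \<Rightarrow> 'v literal set \<Rightarrow> 'v \<Rightarrow> bool option" where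
  "signs V S = (\<lambda>x\<in>V. if Pos x \<in> S then Some True else if Neg x \<in> S then Some False else None)"

text \<open>The test for \<open>Pos x\<close> comes first and would mask \<open>Neg x\<close>; a
  precise clause never contains both.\<close>

lemma signs_eq_Some_iff:
  assumes "precise_clause C" and "x \<in> V"
  shows "signs V (set C) x = Some b \<longleftrightarrow> (if b then Pos x else Neg x) \<in> set C"
  using assms by (auto simp: signs_def precise_clause_def)

text \<open>The sign at \<open>x\<close> tells which literals of \<open>x\<close> occur, and no
  literal has its variable outside \<open>V\<close>.\<close>

lemma inj_on_signs:
  "inj_on (signs V) {set C | C. precise_clause C \<and> literal_var ` set C \<subseteq> V}"
proof (rule inj_onI, clarify)
  fix C D
  assume C: "precise_clause C" "literal_var ` set C \<subseteq> V"
    and D: "precise_clause D" "literal_var ` set D \<subseteq> V"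
    and eq: "signs V (set C) = signs V (set D)"
  have iff: "(if b then Pos x else Neg x) \<in> set C \<longleftrightarrow> (if b then Pos x else Neg x) \<in> set D"
    if "x \<in> V" for x b
    using signs_eq_Some_iff[OF C(1) that] signs_eq_Some_iff[OF D(1) that] eq by metis
  show "set C = set D"
  proof (rule set_eqI)
    fix l
    show "l \<in> set C \<longleftrightarrow> l \<in> set D"
    proof (cases "literal_var l \<in> V")
      case True
      then show ?thesis
        using iff[of "literal_var l" True] iff[of "literal_var l" False] by (cases l) auto
    next
      case False
      then show ?thesis using C(2) D(2) by blast
    qed
  qed
qed

text \<open>At the variable of a true literal the sign agrees with \<open>a\<close>, so it is
  neither \<open>None\<close> nor the opposite sign.\<close>

lemma signs_of_true_clause:
  assumes "precise_clause C" and "literal_var ` set C \<subseteq> V" and "clause_true a C"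
  shows "signs V (set C) \<in> (V \<rightarrow>\<^sub>E UNIV) - (\<Pi>\<^sub>E x\<in>V. {None, Some (\<not> a x)})"
proof
  show "signs V (set C) \<in> V \<rightarrow>\<^sub>E UNIV"
    by (simp add: signs_def)
  obtain l where l: "l \<in> set C" "literal_true a l"
    using assms(3) by (auto simp: clause_true_def)
  let ?x = "literal_var l"
  have x: "?x \<in> V" using l(1) assms(2) by blast
  have "signs V (set C) ?x = Some (a ?x)"
    unfolding signs_eq_Some_iff[OF assms(1) x] using l by (cases l rule: literal.exhaust) simp_all
  then show "signs V (set C) \<notin> (\<Pi>\<^sub>E x\<in>V. {None, Some (\<not> a x)})"
    using x by (force dest: PiE_mem)
qed

lemma length_satisfiable_pcnf_le:
  assumes "finite V" and "pcnf F" and "cnf_vars F \<subseteq> V" and "satisfiable F"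
  shows "int (length F) \<le> 3 ^ card V - 2 ^ card V"
proof -
  obtain a where a: "\<And>C. C \<in> set F \<Longrightarrow> clause_true a C"
    using assms(4) by (auto simp: satisfiable_def satisfies_def)
  have C: "precise_clause C" "literal_var ` set C \<subseteq> V" if "C \<in> set F" for C
    using assms(2,3) that by (auto simp: pcnf_def cnf_vars_def)
  let ?A = "V \<rightarrow>\<^sub>E (UNIV :: bool option set)" and ?B = "\<Pi>\<^sub>E x\<in>V. {None, Some (\<not> a x)}"
  have fin: "finite ?A" "finite ?B"
    using assms(1) by (auto intro: finite_PiE)
  have "card (UNIV :: bool option set) = 3"
    by (simp add: UNIV_option_conv card_image)
  then have card: "card ?A = 3 ^ card V" "card ?B = 2 ^ card V"
    using assms(1) by (simp_all add: card_PiE numeral_2_eq_2)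
  \<comment> \<open>Distinctness of \<open>map set F\<close> lets clauses be counted as sets, the
    objects on which \<open>signs\<close> is injective.\<close>
  have "length F = card (set ` set F)"
    using assms(2) by (metis pcnf_def distinct_card length_map list.set_map)
  also have "\<dots> \<le> card (?A - ?B)"
  proof (rule card_inj_on_le)
    show "inj_on (signs V) (set ` set F)"
      by (rule inj_on_subset[OF inj_on_signs]) (use C in blast)
    show "signs V ` set ` set F \<subseteq> ?A - ?B"
      using signs_of_true_clause[OF C a] by blast
  qed (use fin in blast)
  also have "\<dots> = 3 ^ card V - 2 ^ card V"
    using card_Diff_subset[of ?B ?A] fin card by (simp add: PiE_mono)
  finally show ?thesis
    \<comment> \<open>The subtraction on \<open>nat\<close> is not truncated, as
      \<open>2 ^ card V\<close> \<le> \<open>3 ^ card V\<close>, so the bound carries over to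
      \<open>int\<close>.\<close>
    by (simp add: of_nat_diff power_mono flip: of_nat_le_iff[where ?'a = int])
qed

theorem theorem2:
  fixes n :: nat and V :: "'v set" and F :: "'v cnf"
  assumes "n \<ge> 1"
    and "finite V" and "card V = n"
    and "pcnf F" and "cnf_vars F \<subseteq> V"
  shows "clause_bound n = 3 ^ n - 2 ^ n \<and>
    (int (length F) > clause_bound n \<longrightarrow> \<not> satisfiable F)"
  using length_satisfiable_pcnf_le[OF assms(2,4,5)] assms(3) by (auto simp: clause_bound_eq)

end
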